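(* For every integer $d\ge 0$ and every $A\in \mathcal{T}^*(d+2)$, there is no irreducible surface of bidegree $(1,d)$ in $\mathbb{F}$ containing $A$.
   Context: Work over $\mathbb{C}$. For $p,\ell\in\mathbb{P}^2$ write $p\ell=p_0\ell_0+p_1\ell_1+p_2\ell_2$. The flag threefold is $\mathbb{F}=\{(p,\ell)\in\mathbb{P}^2\times\mathbb{P}^2 : p\ell=0\}$, with projections $\pi_1(p,\ell)=p$, $\pi_2(p,\ell)=\ell$, and $\mathcal{O}_{\mathbb{F}}(a,b)$ is the restriction of $\mathcal{O}_{\mathbb{P}^2\times\mathbb{P}^2}(a,b)$. A surface of bidegree $(a,b)$ is an effective divisor in $|\mathcal{O}_{\mathbb{F}}(a,b)|$. Curves of bidegree $(1,0)$ are the fibers of $\pi_2$. A smooth conic is a curve $L_{q,m}=\{(p,\ell)\in\mathbb{F} : pm=0,\ q\ell=0\}$ with $q,m\in\mathbb{P}^2$, $qm\ne 0$. A twistor fiber is a curve $L_{q,\bar q}$, $q\in\mathbb{P}^2$ (bar is complex conjugation of coordinates); equivalently, a fiber of the twistor map $\pi:\mathbb{F}\to\mathbb{P}^2$, $\pi(p,\ell)=\bar p\times\ell$ (formal cross product). $\mathcal{T}(n)$ denotes the set of all unions $A$ of $n$ pairwise disjoint twistor fibers, and $\mathcal{T}^*(n)$ is the set of $A\in\mathcal{T}(n)$ such that $\#(L\cap A)\le 2$ for every curve $L$ of bidegree $(1,0)$. *)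

theory Defs
  imports "HOL-Analysis.Finite_Cartesian_Product" "HOL-Library.Disjoint_Sets"
begin

type_synonym cvec = "complex ^ 3"

definition proj_rel :: "cvec \<Rightarrow> cvec \<Rightarrow> bool" where
  "proj_rel v w \<longleftrightarrow> v \<noteq> 0 \<and> w \<noteq> 0 \<and> (\<exists>c. c \<noteq> 0 \<and> w = c *s v)"

lemma part_equivp_proj_rel: "part_equivp proj_rel"
proof (rule part_equivpI)
  have "proj_rel 1 1"
    unfolding proj_rel_def by (metis one_neq_zero vector_smult_lid)
  then show "\<exists>v. proj_rel v v" ..
  show "symp proj_rel"
  proof (rule sympI)
    fix v w assume "proj_rel v w"
    then obtain c where c: "v \<noteq> 0" "w \<noteq> 0" "c \<noteq> 0" "w = c *s v"
      unfolding proj_rel_def by blast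
    then have "v = inverse c *s w" by (simp add: vector_smult_assoc)
    with c show "proj_rel w v"
      unfolding proj_rel_def by (metis inverse_nonzero_iff_nonzero)
  qed
  show "transp proj_rel"
    unfolding transp_def proj_rel_def by (metis mult_eq_0_iff vector_smult_assoc)
qed

text \<open>The complex projective plane: nonzero vectors up to nonzero scalars.\<close>

quotient_type P2 = cvec / partial: proj_rel
  by (rule part_equivp_proj_rel)

definition represents :: "cvec \<Rightarrow> P2 \<Rightarrow> bool" where
  "represents v p \<longleftrightarrow> v \<noteq> 0 \<and> abs_P2 v = p"

text \<open>The complex bilinear (not Hermitian) pairing.\<close>

definition bdot :: "cvec \<Rightarrow> cvec \<Rightarrow> complex" where
  "bdot v w = (\<Sum>i\<in>UNIV. v $ i * w $ i)"

lemma bdot_smult: "bdot (a *s v) (b *s w) = a * b * bdot v w"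
  by (simp add: bdot_def sum_distrib_left mult_ac)

lift_definition incident :: "P2 \<Rightarrow> P2 \<Rightarrow> bool" is "\<lambda>v w. bdot v w = 0"
  by (auto simp: proj_rel_def bdot_smult)

lift_definition conj_P2 :: "P2 \<Rightarrow> P2" is "\<lambda>v. \<chi> i. cnj (v $ i)"
proof -
  fix v w assume "proj_rel v w"
  then obtain c where "v \<noteq> 0" "w \<noteq> 0" "c \<noteq> 0" "w = c *s v"
    unfolding proj_rel_def by blast
  then have "(\<chi> i. cnj (v $ i)) \<noteq> 0" "(\<chi> i. cnj (w $ i)) \<noteq> 0"
      "cnj c \<noteq> 0" "(\<chi> i. cnj (w $ i)) = cnj c *s (\<chi> i. cnj (v $ i))"
    by (auto simp: vec_eq_iff)
  then show "proj_rel (\<chi> i. cnj (v $ i)) (\<chi> i. cnj (w $ i))"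
    unfolding proj_rel_def by blast
qed

definition flag :: "(P2 \<times> P2) set" where
  "flag = {(p, l). incident p l}"


subsection \<open>Curves\<close>

definition curves_1_0 :: "(P2 \<times> P2) set set" where
  "curves_1_0 = range (\<lambda>m. {x \<in> flag. snd x = m})"

text \<open>The curve \<open>L\<^bsub>q,m\<^esub>\<close>; it is a smooth conic when \<open>\<not> incident q m\<close>, which
  is automatic for \<open>m = conj_P2 q\<close>.\<close>

definition conic :: "P2 \<Rightarrow> P2 \<Rightarrow> (P2 \<times> P2) set" where
  "conic q m = {(p, l) \<in> flag. incident p m \<and> incident q l}"

definition twistor_fibers :: "(P2 \<times> P2) set set" where
  "twistor_fibers = range (\<lambda>q. conic q (conj_P2 q))"

definition T_unions :: "nat \<Rightarrow> (P2 \<times> P2) set set" where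
  "T_unions n = {\<Union>\<C> | \<C>. \<C> \<subseteq> twistor_fibers \<and> finite \<C> \<and> card \<C> = n \<and> disjoint \<C>}"

definition T_star :: "nat \<Rightarrow> (P2 \<times> P2) set set" where
  "T_star n = {A \<in> T_unions n. \<forall>L\<in>curves_1_0. finite (L \<inter> A) \<and> card (L \<inter> A) \<le> 2}"


subsection \<open>Bihomogeneous polynomials and the Zariski topology\<close>

definition exponents :: "nat \<Rightarrow> (3 \<Rightarrow> nat) set" where
  "exponents n = {\<alpha>. (\<Sum>i\<in>UNIV. \<alpha> i) = n}"

definition monomial :: "(3 \<Rightarrow> nat) \<Rightarrow> cvec \<Rightarrow> complex" where
  "monomial \<alpha> v = (\<Prod>i\<in>UNIV. v $ i ^ \<alpha> i)"

text \<open>Polynomials over the infinite field of complex numbers are identified with the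
  functions they define. \<open>exponents n\<close> is finite, so the sums below are genuine.\<close>

definition bihomogeneous :: "nat \<Rightarrow> nat \<Rightarrow> (cvec \<times> cvec \<Rightarrow> complex) \<Rightarrow> bool" where
  "bihomogeneous a b f \<longleftrightarrow> (\<exists>c. \<forall>v w. f (v, w) =
     (\<Sum>\<alpha>\<in>exponents a. \<Sum>\<beta>\<in>exponents b. c \<alpha> \<beta> * monomial \<alpha> v * monomial \<beta> w))"

definition vanishes_at :: "(cvec \<times> cvec \<Rightarrow> complex) \<Rightarrow> P2 \<times> P2 \<Rightarrow> bool" where
  "vanishes_at f x \<longleftrightarrow>
     (\<forall>v w. represents v (fst x) \<longrightarrow> represents w (snd x) \<longrightarrow> f (v, w) = 0)"

definition zariski_closed :: "(P2 \<times> P2) set \<Rightarrow> bool" where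
  "zariski_closed Z \<longleftrightarrow>
     (\<exists>S. (\<forall>f\<in>S. \<exists>a b. bihomogeneous a b f) \<and> Z = {x. \<forall>f\<in>S. vanishes_at f x})"

definition zariski_irreducible :: "(P2 \<times> P2) set \<Rightarrow> bool" where
  "zariski_irreducible Z \<longleftrightarrow> Z \<noteq> {} \<and>
     (\<forall>Z1 Z2. zariski_closed Z1 \<longrightarrow> zariski_closed Z2 \<longrightarrow> Z \<subseteq> Z1 \<union> Z2 \<longrightarrow>
        Z \<subseteq> Z1 \<or> Z \<subseteq> Z2)"


subsection \<open>Surfaces\<close>

text \<open>Global sections of \<open>\<O>(a,b)\<close> on the flag threefold are the restrictions of bihomogeneous
  polynomials to the affine cone (the restriction map from the product of planes is
  surjective on global sections because \<open>H\<^sup>1(\<O>(a-1,b-1)) = 0\<close> for \<open>a, b \<ge> 0\<close>).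
  They are extended by 0 outside the cone, so that equality of functions is equality
  of sections.\<close>

definition flag_cone :: "(cvec \<times> cvec) set" where
  "flag_cone = {(v, w). bdot v w = 0}"

definition sections :: "nat \<Rightarrow> nat \<Rightarrow> (cvec \<times> cvec \<Rightarrow> complex) set" where
  "sections a b = {\<lambda>x. if x \<in> flag_cone then f x else 0 | f. bihomogeneous a b f}"

text \<open>The complete linear system \<open>|\<O>(a,b)|\<close>: an effective divisor is a nonzero section
  up to a nonzero scalar.\<close>

definition surfaces :: "nat \<Rightarrow> nat \<Rightarrow> (cvec \<times> cvec \<Rightarrow> complex) set set" where
  "surfaces a b = (sections a b - {\<lambda>_. 0}) // {(s, t). \<exists>c. c \<noteq> 0 \<and> t = (\<lambda>x. c * s x)}"

definition support :: "(cvec \<times> cvec \<Rightarrow> complex) set \<Rightarrow> (P2 \<times> P2) set" where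
  "support D = {x \<in> flag. \<forall>s\<in>D. vanishes_at s x}"

definition irreducible_surface :: "(cvec \<times> cvec \<Rightarrow> complex) set \<Rightarrow> bool" where
  "irreducible_surface D \<longleftrightarrow> zariski_irreducible (support D)"

end

theory Submission
  imports Defs "HOL-Analysis.Cartesian_Space" "HOL-Computational_Algebra.Polynomial"
begin

text \<open>
  Write the section as \<open>f(v, w)\<close>, linear in \<open>v\<close> and of degree \<open>d\<close> in \<open>w\<close>, where \<open>v\<close> represents
  \<open>p\<close> and \<open>w\<close> represents \<open>\<ell>\<close>; only the values with \<open>v w = 0\<close> matter. The twistor fiber of \<open>q\<close>
  lies over the line \<open>q \<ell> = 0\<close> of the plane of the \<open>\<ell>\<close>, and its point over \<open>\<ell>\<close> is
  \<open>p = q\<^sup>* \<times> \<ell>\<close>, where \<open>q\<^sup>*\<close> is the complex conjugate. So the \<open>d + 2\<close> given fibers produce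
  \<open>d + 2\<close> distinct lines \<open>R\<^sub>j\<close>, and since no curve of bidegree \<open>(1,0)\<close> meets three of the
  fibers, no three of these lines are concurrent.

  Over the point where \<open>R\<^sub>i\<close> and \<open>R\<^sub>j\<close> meet, two different points of the fiber of \<open>\<pi>\<^sub>2\<close> lie on
  the surface. This fiber is a projective line on which \<open>f\<close> is linear, so it lies on the surface
  entirely; in particular \<open>f(q\<^sub>i, w) = 0\<close> there (\<open>bihomogeneous_zero_at_meeting_point\<close>). Hence
  the form \<open>f(q\<^sub>i, w)\<close> of degree \<open>d\<close> vanishes at \<open>d + 1\<close> different points of \<open>R\<^sub>i\<close>, so on all of
  \<open>R\<^sub>i\<close>. But \<open>q\<^sub>i\<close> and \<open>q\<^sub>i\<^sup>* \<times> w\<close> are then two different points of the fiber over any \<open>w\<close> in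
  \<open>R\<^sub>i\<close>, and \<open>f\<close> is zero at both, so it is zero on all fibers over \<open>R\<^sub>i\<close>. For each \<open>u\<close> the form
  \<open>f(w \<times> u, w)\<close> of degree \<open>d + 1\<close> now vanishes on the \<open>d + 2\<close> lines \<open>R\<^sub>j\<close>, so it is identically
  zero. Every \<open>v\<close> with \<open>v w = 0\<close> and \<open>w \<noteq> 0\<close> is of the form \<open>w \<times> u\<close>, so the section is zero, which
  is not the equation of a surface.

  Both vanishing arguments are instances of \<open>vanishes_if_zero_on_many_kernels\<close>: a form of degree
  \<open>n\<close> on a vector space that vanishes on more than \<open>n\<close> different hyperplanes is zero.
\<close>

section \<open>Cross products of complex vectors\<close>

definition ccross :: "cvec \<Rightarrow> cvec \<Rightarrow> cvec" where
  "ccross v w = vector [v$2 * w$3 - v$3 * w$2, v$3 * w$1 - v$1 * w$3, v$1 * w$2 - v$2 * w$1]"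

definition conj_vec :: "cvec \<Rightarrow> cvec" where
  "conj_vec v = (\<chi> i. cnj (v $ i))"

lemmas coordinates = vec_eq_iff forall_3 ccross_def bdot_def sum_3

lemma bdot_linear:
  "bdot u (v + w) = bdot u v + bdot u w" "bdot u (v - w) = bdot u v - bdot u w"
  "bdot (v + w) u = bdot v u + bdot w u" "bdot (v - w) u = bdot v u - bdot w u"
  "bdot u (c *s w) = c * bdot u w" "bdot (c *s w) u = c * bdot w u"
  "bdot u 0 = 0" "bdot 0 u = 0"
  by (simp_all add: bdot_def sum.distrib sum_subtractf sum_distrib_left algebra_simps)

lemma bdot_commute: "bdot v w = bdot w v"
  by (simp add: bdot_def mult.commute)

lemma bdot_ccross_self:
  "bdot v (ccross v w) = 0" "bdot w (ccross v w) = 0"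
  "bdot (ccross v w) v = 0" "bdot (ccross v w) w = 0"
  by (simp_all add: coordinates algebra_simps)

lemma triple_product_cyclic: "bdot u (ccross v w) = bdot w (ccross u v)"
  by (simp add: coordinates algebra_simps)

lemma ccross_ccross: "ccross u (ccross v w) = bdot u w *s v - bdot u v *s w"
  by (simp add: coordinates algebra_simps)

lemma ccross_smult_right: "ccross v (c *s w) = c *s ccross v w"
  by (simp add: coordinates algebra_simps)

lemma ccross_commute: "ccross w v = - ccross v w"
  by (simp add: coordinates algebra_simps)

lemma conj_vec_eq_0_iff [simp]: "conj_vec v = 0 \<longleftrightarrow> v = 0"
  by (simp add: vec_eq_iff conj_vec_def)

lemma conj_vec_ccross: "conj_vec (ccross v w) = ccross (conj_vec v) (conj_vec w)"
  by (simp add: coordinates conj_vec_def)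

lemma bdot_conj_self_eq_0_iff: "bdot (conj_vec v) v = 0 \<longleftrightarrow> v = 0"
proof -
  have "bdot (conj_vec v) v = of_real (\<Sum>i\<in>UNIV. (cmod (v $ i))\<^sup>2)"
    by (simp add: bdot_def conj_vec_def complex_norm_square mult.commute del: of_real_power)
  also have "\<dots> = 0 \<longleftrightarrow> (\<forall>i. v $ i = 0)"
    by (subst of_real_eq_0_iff) (simp add: sum_nonneg_eq_0_iff)
  finally show ?thesis by (simp add: vec_eq_iff)
qed

lemma ccross_eq_0_imp_parallel:
  assumes "ccross v w = 0" "w \<noteq> 0"
  shows "\<exists>c. v = c *s w"
proof
  let ?n = "bdot (conj_vec w) w"
  have "?n \<noteq> 0"
    using assms(2) by (simp add: bdot_conj_self_eq_0_iff)
  have "?n *s v - bdot (conj_vec w) v *s w = ccross (conj_vec w) 0"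
    unfolding ccross_ccross[symmetric] assms(1) ..
  then have "?n *s v = bdot (conj_vec w) v *s w"
    by (simp add: coordinates)
  then have "(1 / ?n) *s (?n *s v) = (1 / ?n) *s (bdot (conj_vec w) v *s w)"
    by simp
  then show "v = (bdot (conj_vec w) v / ?n) *s w"
    using \<open>?n \<noteq> 0\<close> by (simp add: vector_smult_assoc)
qed

lemma orthogonal_imp_ccross:
  assumes "bdot v w = 0" "w \<noteq> 0"
  shows "\<exists>u. v = ccross w u"
proof
  let ?c = "conj_vec w"
  have n: "bdot w ?c \<noteq> 0"
    using assms(2) by (simp add: bdot_conj_self_eq_0_iff bdot_commute[of w])
  have "ccross w ((1 / bdot w ?c) *s ccross v ?c) = (1 / bdot w ?c) *s ccross w (ccross v ?c)"
    by (rule ccross_smult_right)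
  also have "\<dots> = v"
    using n assms(1) by (simp add: ccross_ccross bdot_commute[of w v] vector_smult_assoc)
  finally show "v = ccross w ((1 / bdot w ?c) *s ccross v ?c)" ..
qed

lemma orthogonal_to_two_imp_parallel:
  assumes "bdot v a = 0" "bdot v b = 0" "ccross a b \<noteq> 0"
  shows "\<exists>c. v = c *s ccross a b"
  using assms by (intro ccross_eq_0_imp_parallel) (simp_all add: ccross_ccross)

lemma exists_orthogonal_to_one_only:
  assumes "ccross p q \<noteq> 0"
  shows "\<exists>w. bdot p w = 0 \<and> bdot q w \<noteq> 0"
proof
  let ?c = "conj_vec (ccross q p)"
  have "ccross q p \<noteq> 0"
    using assms ccross_commute[of q p] by simp
  then have "bdot ?c (ccross q p) \<noteq> 0"
    by (simp add: bdot_conj_self_eq_0_iff)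
  then show "bdot p (ccross p ?c) = 0 \<and> bdot q (ccross p ?c) \<noteq> 0"
    by (simp add: bdot_ccross_self triple_product_cyclic[of q])
qed

lemma exists_nonzero_orthogonal: "\<exists>w. w \<noteq> 0 \<and> bdot v w = 0"
proof (cases "v$1 = 0 \<and> v$2 = 0")
  case True
  then show ?thesis
    by (intro exI[of _ "vector [1, 0, 0]"]) (auto simp: coordinates)
next
  case False
  then show ?thesis
    by (intro exI[of _ "vector [v$2, - v$1, 0]"]) (auto simp: coordinates)
qed

section \<open>Polynomial functions of one variable\<close>

definition poly_fun :: "nat \<Rightarrow> (complex \<Rightarrow> complex) \<Rightarrow> bool" where
  "poly_fun n h \<longleftrightarrow> (\<exists>p. degree p \<le> n \<and> (\<forall>t. h t = poly p t))"

lemma poly_fun_affine: "poly_fun (Suc 0) (\<lambda>t. a + t * b)"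
  unfolding poly_fun_def by (intro exI[of _ "[:a, b:]"]) simp

lemma poly_fun_const: "poly_fun n (\<lambda>t. c)"
  unfolding poly_fun_def by (intro exI[of _ "[:c:]"]) simp

lemma poly_fun_mult:
  assumes "poly_fun m g" "poly_fun n h"
  shows "poly_fun (m + n) (\<lambda>t. g t * h t)"
proof -
  obtain p q where "degree p \<le> m" "degree q \<le> n" "\<forall>t. g t = poly p t" "\<forall>t. h t = poly q t"
    using assms unfolding poly_fun_def by blast
  then show ?thesis
    unfolding poly_fun_def
    by (intro exI[of _ "p * q"]) (auto intro: degree_mult_le[THEN order_trans])
qed

lemma poly_fun_power: "poly_fun m g \<Longrightarrow> poly_fun (k * m) (\<lambda>t. g t ^ k)"
  by (induction k) (use poly_fun_const[of 0 1] in \<open>auto intro: poly_fun_mult\<close>)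

lemma poly_fun_prod:
  assumes "finite S" "\<And>i. i \<in> S \<Longrightarrow> poly_fun (n i) (g i)"
  shows "poly_fun (\<Sum>i\<in>S. n i) (\<lambda>t. \<Prod>i\<in>S. g i t)"
  using assms by (induction S) (simp_all add: poly_fun_const poly_fun_mult)

lemma poly_fun_sum:
  assumes "\<And>i. i \<in> S \<Longrightarrow> poly_fun n (g i)"
  shows "poly_fun n (\<lambda>t. \<Sum>i\<in>S. g i t)"
proof (cases "finite S")
  case True
  obtain p where p: "\<And>i. i \<in> S \<Longrightarrow> degree (p i) \<le> n \<and> (\<forall>t. g i t = poly (p i) t)"
    using assms unfolding poly_fun_def by metis
  with True show ?thesis
    unfolding poly_fun_def
    by (intro exI[of _ "sum p S"]) (simp add: poly_sum degree_sum_le)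
qed (simp add: poly_fun_const)

lemma poly_fun_many_zeros:
  assumes "poly_fun n h" "finite Z" "n < card Z" "\<And>z. z \<in> Z \<Longrightarrow> h z = 0"
  shows "h t = 0"
proof -
  obtain p where p: "degree p \<le> n" "\<And>t. h t = poly p t"
    using assms(1) unfolding poly_fun_def by blast
  have "p = 0"
  proof (rule ccontr)
    assume "p \<noteq> 0"
    then have "card Z \<le> card {x. poly p x = 0}"
      using assms(4) p(2) by (intro card_mono poly_roots_finite) auto
    also have "\<dots> \<le> degree p"
      using \<open>p \<noteq> 0\<close> by (rule card_poly_roots_bound)
    finally show False
      using p(1) assms(3) by simp
  qed
  with p(2) show ?thesis by simp
qed

section \<open>Functions that vanish on many hyperplanes\<close>

text \<open>A vector space over an infinite field is not a finite union of proper subspaces.\<close>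

lemma exists_avoiding_kernels:
  assumes "vec.subspace V" "finite S" "\<And>s. s \<in> S \<Longrightarrow> \<exists>w\<in>V. bdot s w \<noteq> 0"
  shows "\<exists>b\<in>V. \<forall>s\<in>S. bdot s b \<noteq> 0"
  using assms(2,3)
proof (induction S)
  case empty
  then show ?case
    using vec.subspace_0[OF assms(1)] by blast
next
  case (insert s S)
  obtain b where b: "b \<in> V" "\<forall>r\<in>S. bdot r b \<noteq> 0"
    using insert.IH insert.prems by auto
  obtain c where c: "c \<in> V" "bdot s c \<noteq> 0"
    using insert.prems by auto
  \<comment> \<open>On the line \<open>b + t c\<close> each form in \<open>insert s S\<close> has at most one zero.\<close>
  let ?bad = "(\<lambda>r. - bdot r b / bdot r c) ` insert s S"
  have "finite ?bad"
    using insert.hyps(1) by simp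
  from ex_new_if_finite[OF infinite_UNIV_char_0 this]
  obtain t where t: "t \<notin> ?bad" ..
  have "bdot r (b + t *s c) \<noteq> 0" if "r \<in> insert s S" for r
  proof (cases "bdot r c = 0")
    case True
    with that b c show ?thesis by (auto simp: bdot_linear)
  next
    case False
    have "- bdot r b / bdot r c \<in> ?bad"
      using that by (rule imageI)
    with t have "t \<noteq> - bdot r b / bdot r c"
      by metis
    with False show ?thesis
      by (simp add: bdot_linear field_simps add_eq_0_iff)
  qed
  moreover have "b + t *s c \<in> V"
    using assms(1) b(1) c(1) by (intro vec.subspace_add vec.subspace_scale)
  ultimately show ?case by blast
qed

text \<open>
  Restrict \<open>g\<close> to a line through the point \<open>a\<close> in question. If its direction \<open>b\<close> is general, the
  line meets the hyperplanes in different points, and a polynomial of degree at most \<open>n\<close> has at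
  most \<open>n\<close> zeros.
\<close>

lemma vanishes_if_zero_on_many_kernels:
  assumes V: "vec.subspace V" and J: "finite J" "n < card J"
    and poly: "\<And>a b. a \<in> V \<Longrightarrow> b \<in> V \<Longrightarrow> poly_fun n (\<lambda>t. g (a + t *s b))"
    and nonzero: "\<And>j. j \<in> J \<Longrightarrow> \<exists>w\<in>V. bdot (q j) w \<noteq> 0"
    and distinct: "\<And>j k. j \<in> J \<Longrightarrow> k \<in> J \<Longrightarrow> j \<noteq> k \<Longrightarrow>
       \<exists>w\<in>V. bdot (q j) w = 0 \<and> bdot (q k) w \<noteq> 0"
    and zero: "\<And>j w. j \<in> J \<Longrightarrow> w \<in> V \<Longrightarrow> bdot (q j) w = 0 \<Longrightarrow> g w = 0"
    and a: "a \<in> V"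
  shows "g a = 0"
proof (cases "\<exists>j\<in>J. bdot (q j) a = 0")
  case True
  with zero a show ?thesis by blast
next
  case False
  let ?s = "\<lambda>(j, k). bdot (q k) a *s q j - bdot (q j) a *s q k"
  let ?pairs = "{(j, k) \<in> J \<times> J. j \<noteq> k}"
  \<comment> \<open>The line \<open>a + t b\<close> meets the kernels of \<open>q j\<close> and \<open>q k\<close> in the same point only if \<open>b\<close> is in
    the kernel of \<open>?s (j, k)\<close>.\<close>
  have fin: "finite ?pairs"
    using J(1) by (rule_tac finite_subset[of _ "J \<times> J"]) auto
  have "\<exists>b\<in>V. \<forall>s \<in> q ` J \<union> ?s ` ?pairs. bdot s b \<noteq> 0"
  proof (rule exists_avoiding_kernels[OF V])
    show "finite (q ` J \<union> ?s ` ?pairs)"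
      using fin J(1) by simp
    fix s assume "s \<in> q ` J \<union> ?s ` ?pairs"
    then consider j where "j \<in> J" "s = q j"
      | j k where "j \<in> J" "k \<in> J" "j \<noteq> k" "s = bdot (q k) a *s q j - bdot (q j) a *s q k"
      by auto
    then show "\<exists>w\<in>V. bdot s w \<noteq> 0"
    proof cases
      case 1
      then show ?thesis using nonzero by simp
    next
      case 2
      obtain w where "w \<in> V" "bdot (q j) w = 0" "bdot (q k) w \<noteq> 0"
        using distinct[OF 2(1-3)] by blast
      then show ?thesis
        using 2 False by (intro bexI[of _ w]) (auto simp: bdot_linear)
    qed
  qed
  then obtain b where b: "b \<in> V" "\<And>j. j \<in> J \<Longrightarrow> bdot (q j) b \<noteq> 0"
    and sep: "\<And>j k. j \<in> J \<Longrightarrow> k \<in> J \<Longrightarrow> j \<noteq> k \<Longrightarrow>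
      bdot (bdot (q k) a *s q j - bdot (q j) a *s q k) b \<noteq> 0"
    by (fastforce simp: ball_Un)
  let ?t = "\<lambda>j. - bdot (q j) a / bdot (q j) b"
  have inj: "inj_on ?t J"
  proof (rule inj_onI, rule ccontr)
    fix j k assume jk: "j \<in> J" "k \<in> J" "?t j = ?t k" "j \<noteq> k"
    then have "bdot (q j) a * bdot (q k) b = bdot (q k) a * bdot (q j) b"
      using b(2)[of j] b(2)[of k] by (simp add: frac_eq_eq)
    with sep[OF jk(1,2,4)] show False
      by (simp add: bdot_linear)
  qed
  have "g (a + 0 *s b) = 0"
  proof (rule poly_fun_many_zeros[where h = "\<lambda>t. g (a + t *s b)" and Z = "?t ` J"])
    show "poly_fun n (\<lambda>t. g (a + t *s b))"
      using poly a b(1) .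
    show "finite (?t ` J)" "n < card (?t ` J)"
      using J inj by (simp_all add: card_image)
    fix z assume "z \<in> ?t ` J"
    then obtain j where j: "j \<in> J" "z = ?t j" by blast
    then have "bdot (q j) (a + z *s b) = 0"
      using b(2)[of j] by (simp add: bdot_linear)
    moreover have "a + z *s b \<in> V"
      using V a b(1) by (intro vec.subspace_add vec.subspace_scale)
    ultimately show "g (a + z *s b) = 0"
      using zero j(1) by blast
  qed
  then show ?thesis by simp
qed

section \<open>Bihomogeneous polynomials\<close>

lemma poly_fun_bihomogeneous:
  assumes f: "bihomogeneous a b f"
    and v: "\<And>i. poly_fun m (\<lambda>t. v t $ i)" and w: "\<And>i. poly_fun n (\<lambda>t. w t $ i)"
  shows "poly_fun (a * m + b * n) (\<lambda>t. f (v t, w t))"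
proof -
  have mono: "poly_fun (e * k) (\<lambda>t. monomial \<alpha> (u t))"
    if "\<alpha> \<in> exponents e" "\<And>i. poly_fun k (\<lambda>t. u t $ i)" for \<alpha> e k u
  proof -
    have "poly_fun (\<Sum>i\<in>UNIV. \<alpha> i * k) (\<lambda>t. \<Prod>i\<in>UNIV. u t $ i ^ \<alpha> i)"
      by (intro poly_fun_prod poly_fun_power that) simp
    then show ?thesis
      using that(1) by (simp add: monomial_def exponents_def flip: sum_distrib_right)
  qed
  obtain c where c: "\<And>v w. f (v, w) =
      (\<Sum>\<alpha>\<in>exponents a. \<Sum>\<beta>\<in>exponents b. c \<alpha> \<beta> * monomial \<alpha> v * monomial \<beta> w)"
    using f unfolding bihomogeneous_def by blast
  have "poly_fun (0 + a * m + b * n) (\<lambda>t. c \<alpha> \<beta> * monomial \<alpha> (v t) * monomial \<beta> (w t))"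
    if "\<alpha> \<in> exponents a" "\<beta> \<in> exponents b" for \<alpha> \<beta>
    by (intro poly_fun_mult poly_fun_const mono that v w)
  then show ?thesis
    unfolding c by (intro poly_fun_sum) simp
qed

lemma bihomogeneous_linear:
  assumes "bihomogeneous 1 d f"
  shows "f (x *s u + y *s v, w) = x * f (u, w) + y * f (v, w)"
proof -
  have lin: "monomial \<alpha> (x *s u + y *s v) = x * monomial \<alpha> u + y * monomial \<alpha> v"
    if \<alpha>: "\<alpha> \<in> exponents 1" for \<alpha> and u v :: cvec
  proof -
    obtain i where i: "\<alpha> i = 1" "\<And>j. j \<noteq> i \<Longrightarrow> \<alpha> j = 0"
      using \<alpha> sum_eq_1_iff[of UNIV \<alpha>] unfolding exponents_def by auto
    have "monomial \<alpha> z = z $ i" for z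
    proof -
      have "monomial \<alpha> z = (\<Prod>j\<in>{i}. z $ j ^ \<alpha> j)"
        unfolding monomial_def by (rule prod.mono_neutral_right) (auto simp: i)
      then show ?thesis by (simp add: i)
    qed
    then show ?thesis by simp
  qed
  obtain c where c: "\<And>v w. f (v, w) =
      (\<Sum>\<alpha>\<in>exponents 1. \<Sum>\<beta>\<in>exponents d. c \<alpha> \<beta> * monomial \<alpha> v * monomial \<beta> w)"
    using assms unfolding bihomogeneous_def by blast
  show ?thesis
    unfolding c sum_distrib_left sum.distrib[symmetric]
    by (intro sum.cong refl) (simp add: lin algebra_simps)
qed

lemma bihomogeneous_linear':
  assumes "bihomogeneous 1 d f"
  shows "f (x *s u - y *s v, w) = x * f (u, w) - y * f (v, w)"
    and "f (0, w) = 0"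
  using bihomogeneous_linear[OF assms, of x u "-y" v w]
    bihomogeneous_linear[OF assms, of 0 0 0 0 w]
  by simp_all

lemma bihomogeneous_at_zero:
  assumes "bihomogeneous a b f" "f (v, w) = 0"
  shows "f (v, 0) = 0"
proof -
  have hom: "monomial \<beta> (0 *s w) = 0 ^ b * monomial \<beta> w" if "\<beta> \<in> exponents b" for \<beta>
  proof -
    have "monomial \<beta> (0 *s w) = (\<Prod>i\<in>UNIV. 0 ^ \<beta> i) * monomial \<beta> w"
      by (simp only: monomial_def vector_smult_component power_mult_distrib prod.distrib)
    also have "(\<Prod>i\<in>UNIV. 0 ^ \<beta> i) = (0 ^ b :: complex)"
      using that by (simp add: exponents_def flip: power_sum)
    finally show ?thesis .
  qed
  obtain c where c: "\<And>v w. f (v, w) =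
      (\<Sum>\<alpha>\<in>exponents a. \<Sum>\<beta>\<in>exponents b. c \<alpha> \<beta> * monomial \<alpha> v * monomial \<beta> w)"
    using assms unfolding bihomogeneous_def by blast
  have "f (v, 0 *s w) = 0 ^ b * f (v, w)"
    unfolding c sum_distrib_left by (intro sum.cong refl) (simp only: hom mult_ac)
  with assms(2) show ?thesis by simp
qed

section \<open>Sections that vanish on the twistor fibers\<close>

text \<open>
  The two conditions on \<open>f\<close> are linear equations for \<open>f(p, w)\<close> and \<open>f(q, w)\<close>. Their determinant
  is \<open>\<bar>p\<bar>\<^sup>2 \<bar>q\<bar>\<^sup>2 - \<bar>\<langle>p, q\<rangle>\<bar>\<^sup>2\<close> up to sign, which is \<open>\<bar>p \<times> q\<bar>\<^sup>2\<close> by Lagrange's identity.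
\<close>

lemma bihomogeneous_zero_at_meeting_point:
  assumes f: "bihomogeneous 1 d f"
    and w: "w \<noteq> 0" "bdot p w = 0" "bdot q w = 0" and pq: "ccross p q \<noteq> 0"
    and zero: "f (ccross (conj_vec p) w, w) = 0" "f (ccross (conj_vec q) w, w) = 0"
  shows "f (p, w) = 0"
proof -
  obtain k where k: "w = k *s ccross p q"
    using orthogonal_to_two_imp_parallel[OF _ _ pq, of w] w(2,3)
    by (auto simp: bdot_commute[of w])
  with w(1) have "k \<noteq> 0" by auto
  have eq: "bdot z q * f (p, w) - bdot z p * f (q, w) = 0" if "f (ccross z w, w) = 0" for z
  proof -
    have "ccross z w = (k * bdot z q) *s p - (k * bdot z p) *s q"
      unfolding k by (simp add: coordinates algebra_simps)
    with that have "k * bdot z q * f (p, w) - k * bdot z p * f (q, w) = 0"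
      by (simp add: bihomogeneous_linear'(1)[OF f])
    then have "k * (bdot z q * f (p, w) - bdot z p * f (q, w)) = 0"
      by (simp add: algebra_simps)
    with \<open>k \<noteq> 0\<close> show ?thesis by simp
  qed
  let ?P = "conj_vec p" and ?Q = "conj_vec q"
  have "bdot (conj_vec (ccross p q)) (ccross p q) * f (p, w) =
      bdot ?P p * (bdot ?Q q * f (p, w) - bdot ?Q p * f (q, w))
      - bdot ?Q p * (bdot ?P q * f (p, w) - bdot ?P p * f (q, w))"
    unfolding conj_vec_ccross by (simp add: coordinates algebra_simps)
  also have "\<dots> = 0"
    using eq[OF zero(1)] eq[OF zero(2)] by simp
  finally show ?thesis
    using pq by (simp add: bdot_conj_self_eq_0_iff)
qed

text \<open>
  The orthogonal complement of \<open>w\<close> is spanned by \<open>q\<close> and \<open>z \<times> w\<close>: subtracting a multiple of \<open>q\<close>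
  makes \<open>v\<close> orthogonal to \<open>z\<close> as well.
\<close>

lemma bihomogeneous_zero_on_orthogonal:
  assumes f: "bihomogeneous 1 d f"
    and q: "bdot q w = 0" "w \<noteq> 0" "bdot z q \<noteq> 0"
    and zero: "f (q, w) = 0" "f (ccross z w, w) = 0"
    and v: "bdot v w = 0"
  shows "f (v, w) = 0"
proof -
  have nz: "ccross z w \<noteq> 0"
  proof
    assume "ccross z w = 0"
    then obtain c where "z = c *s w"
      using ccross_eq_0_imp_parallel q(2) by blast
    with q(1,3) show False by (simp add: bdot_linear bdot_commute[of w q])
  qed
  let ?r = "bdot v z / bdot z q"
  have "bdot (v - ?r *s q) z = 0" "bdot (v - ?r *s q) w = 0"
    using q v by (simp_all add: bdot_linear bdot_commute[of q z])
  then obtain c where "v - ?r *s q = c *s ccross z w"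
    using orthogonal_to_two_imp_parallel nz by blast
  then have "v = ?r *s q + c *s ccross z w"
    by (simp add: algebra_simps)
  then show ?thesis
    using bihomogeneous_linear[OF f, of ?r q c "ccross z w" w] zero by simp
qed

text \<open>
  This is the whole argument in coordinates: \<open>d + 2\<close> different lines in the plane of the \<open>\<ell>\<close>, no
  three of them concurrent, and a section that vanishes on the twistor fibers over them.
\<close>

lemma bihomogeneous_zero_on_cone:
  fixes q :: "'i \<Rightarrow> cvec"
  assumes f: "bihomogeneous 1 d f"
    and J: "finite J" "card J = d + 2"
    and q: "\<And>j. j \<in> J \<Longrightarrow> q j \<noteq> 0"
    and lines_distinct: "\<And>j k. j \<in> J \<Longrightarrow> k \<in> J \<Longrightarrow> j \<noteq> k \<Longrightarrow> ccross (q j) (q k) \<noteq> 0"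
    and not_concurrent: "\<And>i j k w. i \<in> J \<Longrightarrow> j \<in> J \<Longrightarrow> k \<in> J \<Longrightarrow> i \<noteq> j \<Longrightarrow> i \<noteq> k \<Longrightarrow> j \<noteq> k \<Longrightarrow>
      bdot (q i) w = 0 \<Longrightarrow> bdot (q j) w = 0 \<Longrightarrow> bdot (q k) w = 0 \<Longrightarrow> w = 0"
    and zero: "\<And>j w. j \<in> J \<Longrightarrow> w \<noteq> 0 \<Longrightarrow> bdot (q j) w = 0 \<Longrightarrow>
      f (ccross (conj_vec (q j)) w, w) = 0"
    and vw: "bdot v w = 0"
  shows "f (v, w) = 0"
proof -
  have cone: "f (v, w) = 0"
    if j: "j \<in> J" and w: "w \<noteq> 0" "bdot (q j) w = 0" and v: "bdot v w = 0"
      and qw: "f (q j, w) = 0" for j v w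
  proof (rule bihomogeneous_zero_on_orthogonal[OF f w(2,1) _ qw zero[OF j w] v])
    show "bdot (conj_vec (q j)) (q j) \<noteq> 0"
      using q[OF j] by (simp add: bdot_conj_self_eq_0_iff)
  qed

  have meeting: "f (q i, w) = 0"
    if ij: "i \<in> J" "j \<in> J" "i \<noteq> j" and w: "bdot (q i) w = 0" "bdot (q j) w = 0" for i j w
  proof -
    have *: "f (q i, w) = 0" if "w \<noteq> 0" "bdot (q i) w = 0" "bdot (q j) w = 0" for w
      using bihomogeneous_zero_at_meeting_point[OF f that lines_distinct[OF ij]] zero ij that
      by blast
    show ?thesis
    proof (cases "w = 0")
      case True
      \<comment> \<open>If \<open>d = 0\<close>, the value at \<open>w = 0\<close> need not be \<open>0\<close> by homogeneity alone, but it agrees with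
        the value at a nonzero point of the intersection.\<close>
      have "f (q i, ccross (q i) (q j)) = 0"
        by (intro * lines_distinct ij bdot_ccross_self)
      then show ?thesis
        unfolding True by (rule bihomogeneous_at_zero[OF f])
    qed (use * w in blast)
  qed

  have on_line: "f (q i, w) = 0" if i: "i \<in> J" and w: "bdot (q i) w = 0" for i w
  proof -
    let ?V = "{w. bdot (q i) w = 0}"
    have sep: "\<exists>w\<in>?V. bdot (q j) w \<noteq> 0" if "j \<in> J - {i}" for j
    proof -
      have "ccross (q i) (q j) \<noteq> 0"
        using lines_distinct i that by blast
      then show ?thesis
        using exists_orthogonal_to_one_only by blast
    qed
    show ?thesis
    proof (rule vanishes_if_zero_on_many_kernels[where V = ?V and J = "J - {i}" and q = q
          and g = "\<lambda>w. f (q i, w)" and n = d])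
      show "vec.subspace ?V"
        by (simp add: vec.subspace_def bdot_linear)
      show "finite (J - {i})" "d < card (J - {i})"
        using J i by simp_all
      show "poly_fun d (\<lambda>t. f (q i, a + t *s b))" for a b
      proof -
        have "poly_fun (1 * 0 + d * Suc 0) (\<lambda>t. f (q i, a + t *s b))"
          by (rule poly_fun_bihomogeneous[OF f]) (simp_all add: poly_fun_const poly_fun_affine)
        then show ?thesis by simp
      qed
      show "\<exists>w\<in>?V. bdot (q j) w \<noteq> 0" if "j \<in> J - {i}" for j
        using sep that .
      show "\<exists>w\<in>?V. bdot (q j) w = 0 \<and> bdot (q k) w \<noteq> 0"
        if "j \<in> J - {i}" "k \<in> J - {i}" "j \<noteq> k" for j k
      proof
        let ?w = "ccross (q i) (q j)"
        have "?w \<noteq> 0"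
          using lines_distinct i that by blast
        then have "bdot (q k) ?w \<noteq> 0"
          using not_concurrent[OF i _ _ _ _ that(3) bdot_ccross_self(1,2)] that by blast
        then show "bdot (q j) ?w = 0 \<and> bdot (q k) ?w \<noteq> 0"
          using bdot_ccross_self(2) by blast
        show "?w \<in> ?V"
          by (simp add: bdot_ccross_self)
      qed
      show "f (q i, w) = 0" if "j \<in> J - {i}" "w \<in> ?V" "bdot (q j) w = 0" for j w
        using meeting[OF i, of j w] that by blast
      show "w \<in> ?V"
        using w by simp
    qed
  qed

  have ccross_zero: "f (ccross w u, w) = 0" for w u
  proof (rule vanishes_if_zero_on_many_kernels[where V = UNIV and J = J and q = q
        and g = "\<lambda>w. f (ccross w u, w)" and n = "d + 1"])
    show "finite J" "d + 1 < card J"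
      using J by simp_all
    show "poly_fun (d + 1) (\<lambda>t. f (ccross (a + t *s b) u, a + t *s b))" for a b
    proof -
      have "ccross (a + t *s b) u = ccross a u + t *s ccross b u" for t
        by (simp add: coordinates algebra_simps)
      then show ?thesis
        using poly_fun_bihomogeneous[OF f, of "Suc 0" "\<lambda>t. ccross a u + t *s ccross b u"
            "Suc 0" "\<lambda>t. a + t *s b"]
        by (simp add: poly_fun_affine add.commute)
    qed
    show "\<exists>w\<in>UNIV. bdot (q j) w \<noteq> 0" if "j \<in> J" for j
      using q[OF that] bdot_conj_self_eq_0_iff[of "q j"]
      by (intro bexI[of _ "conj_vec (q j)"]) (simp_all add: bdot_commute[of "q j"])
    show "\<exists>w\<in>UNIV. bdot (q j) w = 0 \<and> bdot (q k) w \<noteq> 0" if "j \<in> J" "k \<in> J" "j \<noteq> k" for j k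
      using exists_orthogonal_to_one_only[OF lines_distinct[OF that]] by simp
    show "f (ccross w u, w) = 0" if "j \<in> J" "bdot (q j) w = 0" for j w
    proof (cases "w = 0")
      case True
      then have "ccross w u = 0"
        by (simp add: coordinates)
      then show ?thesis
        using bihomogeneous_linear'(2)[OF f] by simp
    next
      case False
      show ?thesis
        by (rule cone[OF that(1) False that(2) bdot_ccross_self(3) on_line[OF that]])
    qed
  qed (simp_all add: vec.subspace_UNIV)

  have nonzero: "f (v, w) = 0" if "w \<noteq> 0" "bdot v w = 0" for w
    using orthogonal_imp_ccross[OF that(2,1)] ccross_zero by blast
  show ?thesis
  proof (cases "w = 0")
    case True
    \<comment> \<open>The cone contains the pairs \<open>(v, 0)\<close>, which represent no point of the flag threefold;
      homogeneity carries the vanishing over to them.\<close>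
    obtain w' where "w' \<noteq> 0" "bdot v w' = 0"
      using exists_nonzero_orthogonal by blast
    then show ?thesis
      unfolding True using bihomogeneous_at_zero[OF f] nonzero by blast
  qed (use nonzero vw in blast)
qed

section \<open>Twistor fibers in coordinates\<close>

lemma proj_rel_refl_iff: "proj_rel v v \<longleftrightarrow> v \<noteq> 0"
  unfolding proj_rel_def by (metis one_neq_zero vector_smult_lid)

lemma exists_represents: "\<exists>v. represents v p"
  using Quotient_abs_rep[OF Quotient_P2] Quotient_rep_reflp[OF Quotient_P2]
  unfolding represents_def proj_rel_refl_iff by metis

lemma abs_P2_smult: "v \<noteq> 0 \<Longrightarrow> c \<noteq> 0 \<Longrightarrow> abs_P2 (c *s v) = abs_P2 v"
  using Quotient_rel_abs[OF Quotient_P2, of v "c *s v"] by (auto simp: proj_rel_def)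

lemma incident_abs_P2:
  "v \<noteq> 0 \<Longrightarrow> w \<noteq> 0 \<Longrightarrow> incident (abs_P2 v) (abs_P2 w) \<longleftrightarrow> bdot v w = 0"
  by (rule incident.abs_eq) (simp_all add: proj_rel_refl_iff)

lemma conj_P2_abs_P2: "v \<noteq> 0 \<Longrightarrow> conj_P2 (abs_P2 v) = abs_P2 (conj_vec v)"
  unfolding conj_vec_def by (rule conj_P2.abs_eq) (simp add: proj_rel_refl_iff)

definition twistor_fiber :: "cvec \<Rightarrow> (P2 \<times> P2) set" where
  "twistor_fiber q = conic (abs_P2 q) (conj_P2 (abs_P2 q))"

lemma twistor_fibers_eq: "twistor_fibers = twistor_fiber ` {q. q \<noteq> 0}"
proof -
  have "p \<in> abs_P2 ` {q. q \<noteq> 0}" for p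
    using exists_represents[of p] by (auto simp: represents_def)
  then have "abs_P2 ` {q. q \<noteq> 0} = UNIV"
    by blast
  then show ?thesis
    using image_image[of "\<lambda>p. conic p (conj_P2 p)" abs_P2 "{q. q \<noteq> 0}"]
    by (simp add: twistor_fibers_def twistor_fiber_def)
qed

text \<open>
  A point \<open>p\<close> of the twistor fiber over \<open>w\<close> has to satisfy \<open>p q\<^sup>* = 0\<close> and \<open>p w = 0\<close>, which the
  cross product does. It is nonzero because \<open>q w = 0\<close> but \<open>q q\<^sup>* \<noteq> 0\<close>, so \<open>w\<close> and \<open>q\<^sup>*\<close> are
  independent.
\<close>

lemma twistor_fiber_point:
  assumes "q \<noteq> 0" "w \<noteq> 0" "bdot q w = 0"
  shows "ccross (conj_vec q) w \<noteq> 0"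
    and "(abs_P2 (ccross (conj_vec q) w), abs_P2 w) \<in> twistor_fiber q"
proof -
  let ?v = "ccross (conj_vec q) w"
  show nz: "?v \<noteq> 0"
  proof
    assume "?v = 0"
    then obtain c where "conj_vec q = c *s w"
      using ccross_eq_0_imp_parallel assms(2) by blast
    then have "bdot (conj_vec q) q = 0"
      using assms(3) by (simp add: bdot_linear bdot_commute[of w q])
    with assms(1) show False
      by (simp add: bdot_conj_self_eq_0_iff)
  qed
  have "bdot ?v w = 0" "bdot ?v (conj_vec q) = 0"
    by (rule bdot_ccross_self)+
  then show "(abs_P2 ?v, abs_P2 w) \<in> twistor_fiber q"
    using assms nz
    by (simp add: twistor_fiber_def conic_def flag_def incident_abs_P2 conj_P2_abs_P2)
qed

lemma twistor_fiber_eq_if_parallel: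
  assumes "p \<noteq> 0" "q \<noteq> 0" "ccross p q = 0"
  shows "twistor_fiber p = twistor_fiber q"
proof -
  obtain c where "p = c *s q"
    using ccross_eq_0_imp_parallel assms(2,3) by blast
  with assms(1,2) have "abs_P2 p = abs_P2 q"
    using abs_P2_smult[of q c] by auto
  then show ?thesis by (simp add: twistor_fiber_def)
qed

text \<open>
  Three concurrent lines would give three points of \<open>A\<close> in one fiber of \<open>\<pi>\<^sub>2\<close>; the points are
  different because the twistor fibers are disjoint.
\<close>

lemma T_star_not_concurrent:
  assumes card: "\<forall>L\<in>curves_1_0. finite (L \<inter> \<Union>\<C>) \<and> card (L \<inter> \<Union>\<C>) \<le> 2"
    and disj: "disjoint \<C>"
    and fibers: "{twistor_fiber p, twistor_fiber q, twistor_fiber r} \<subseteq> \<C>"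
      "twistor_fiber p \<noteq> twistor_fiber q" "twistor_fiber p \<noteq> twistor_fiber r"
      "twistor_fiber q \<noteq> twistor_fiber r"
    and nz: "p \<noteq> 0" "q \<noteq> 0" "r \<noteq> 0"
    and w: "bdot p w = 0" "bdot q w = 0" "bdot r w = 0"
  shows "w = 0"
proof (rule ccontr)
  assume "w \<noteq> 0"
  let ?x = "\<lambda>q. (abs_P2 (ccross (conj_vec q) w), abs_P2 w)"
  let ?L = "{x \<in> flag. snd x = abs_P2 w}"
  have x: "?x p \<in> twistor_fiber p" "?x q \<in> twistor_fiber q" "?x r \<in> twistor_fiber r"
    using twistor_fiber_point(2) \<open>w \<noteq> 0\<close> nz w by blast+
  have "twistor_fiber p \<inter> twistor_fiber q = {}" "twistor_fiber p \<inter> twistor_fiber r = {}"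
    "twistor_fiber q \<inter> twistor_fiber r = {}"
    using disjointD[OF disj] fibers by auto
  with x have distinct: "?x p \<noteq> ?x q" "?x p \<noteq> ?x r" "?x q \<noteq> ?x r"
    by (metis disjoint_iff)+
  have "twistor_fiber z \<subseteq> flag" for z
    by (auto simp: twistor_fiber_def conic_def)
  with x fibers(1) have sub: "{?x p, ?x q, ?x r} \<subseteq> ?L \<inter> \<Union>\<C>"
    by auto
  have "?L \<in> curves_1_0"
    by (auto simp: curves_1_0_def)
  with card have "finite (?L \<inter> \<Union>\<C>)" "card (?L \<inter> \<Union>\<C>) \<le> 2"
    by blast+
  then have "card {?x p, ?x q, ?x r} \<le> 2"
    using card_mono[OF _ sub] by linarith
  moreover have "card {?x p, ?x q, ?x r} = 3"
    using distinct unfolding card_3_iff by blast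
  ultimately show False by simp
qed

text \<open>The divisor \<open>D\<close> is the class of its equations up to scalars; one of them suffices.\<close>

lemma surface_equation:
  assumes "D \<in> surfaces a b"
  obtains f s where "bihomogeneous a b f" "s \<in> D" "s \<noteq> (\<lambda>_. 0)"
    "s = (\<lambda>x. if x \<in> flag_cone then f x else 0)"
proof -
  obtain s where s: "s \<in> sections a b" "s \<noteq> (\<lambda>_. 0)"
    and D: "D = {(s, t). \<exists>c. c \<noteq> 0 \<and> t = (\<lambda>x. c * s x)} `` {s}"
    using assms unfolding surfaces_def by (auto elim!: quotientE)
  have "s \<in> D"
    unfolding D by (auto intro: exI[of _ 1])
  with s that show ?thesis
    unfolding sections_def by blast
qed

theorem theorem1p1:
  fixes d :: nat and A :: "(P2 \<times> P2) set"
  assumes "A \<in> T_star (d + 2)"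
  shows "\<not> (\<exists>D \<in> surfaces 1 d. irreducible_surface D \<and> A \<subseteq> support D)"
proof (intro notI, elim bexE conjE)
  fix D assume D: "D \<in> surfaces 1 d" and AD: "A \<subseteq> support D"
  obtain \<C> where A: "A = \<Union>\<C>"
    and \<C>: "\<C> \<subseteq> twistor_fibers" "finite \<C>" "card \<C> = d + 2" "disjoint \<C>"
    using assms unfolding T_star_def T_unions_def by blast
  have star: "\<forall>L\<in>curves_1_0. finite (L \<inter> \<Union>\<C>) \<and> card (L \<inter> \<Union>\<C>) \<le> 2"
    using assms unfolding T_star_def A by blast
  obtain q where q: "\<And>C. C \<in> \<C> \<Longrightarrow> q C \<noteq> 0 \<and> twistor_fiber (q C) = C"
  proof -
    have "\<forall>C\<in>\<C>. \<exists>v. v \<noteq> 0 \<and> twistor_fiber v = C"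
      using \<C>(1) unfolding twistor_fibers_eq by blast
    then show ?thesis
      using that by metis
  qed
  obtain f s where f: "bihomogeneous 1 d f" and s: "s \<in> D" "s \<noteq> (\<lambda>_. 0)"
    and s_def: "s = (\<lambda>x. if x \<in> flag_cone then f x else 0)"
    using D by (rule surface_equation)
  have "f (v, w) = 0" if "bdot v w = 0" for v w
  proof (rule bihomogeneous_zero_on_cone[OF f \<C>(2,3), where q = q])
    show "q C \<noteq> 0" if "C \<in> \<C>" for C
      using q that by blast
    show "ccross (q C) (q C') \<noteq> 0" if "C \<in> \<C>" "C' \<in> \<C>" "C \<noteq> C'" for C C'
      using twistor_fiber_eq_if_parallel[of "q C" "q C'"] q[OF that(1)] q[OF that(2)] that(3)
      by auto
    show "u = 0" if "C \<in> \<C>" "C' \<in> \<C>" "C'' \<in> \<C>" "C \<noteq> C'" "C \<noteq> C''" "C' \<noteq> C''"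
      "bdot (q C) u = 0" "bdot (q C') u = 0" "bdot (q C'') u = 0" for C C' C'' u
      by (rule T_star_not_concurrent[OF star \<C>(4), of "q C" "q C'" "q C''"]) (simp_all add: q that)
    show "f (ccross (conj_vec (q C)) u, u) = 0"
      if C: "C \<in> \<C>" and u: "u \<noteq> 0" "bdot (q C) u = 0" for C u
    proof -
      let ?v = "ccross (conj_vec (q C)) u"
      have nz: "?v \<noteq> 0" and "(abs_P2 ?v, abs_P2 u) \<in> twistor_fiber (q C)"
        using twistor_fiber_point[of "q C" u] q[OF C] u by blast+
      then have "(abs_P2 ?v, abs_P2 u) \<in> support D"
        using AD A C q by auto
      then have "s (?v, u) = 0"
        using s(1) nz u(1) by (auto simp: support_def vanishes_at_def represents_def)
      moreover have "(?v, u) \<in> flag_cone"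
        by (simp add: flag_cone_def bdot_ccross_self)
      ultimately show ?thesis
        by (simp add: s_def)
    qed
    show "bdot v w = 0"
      using that .
  qed
  then have "s = (\<lambda>_. 0)"
    by (auto simp: s_def flag_cone_def)
  with s(2) show False ..
qed

end
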